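(* Let $B$ and $B'$ be matrices in $\mathbb{C}^{d\times d}$. Then the matrix function $\Gamma_2(B,B';x,y)$ satisfies the following infinite summation formulae for $|t|<1$: (1) $(1-t)^{-B}\,\Gamma_2\!\left(B,B';x(1-t),\frac{y}{1-t}\right)=\sum_{n=0}^{\infty}\frac{(B)_n}{n!}\,\Gamma_2(B+nI,B';x,y)\,t^n$; (2) $\Gamma_2\!\left(B,B';\frac{x}{1-t},y(1-t)\right)(1-t)^{-B'}=\sum_{n=0}^{\infty}\Gamma_2(B,B'+nI;x,y)\,\frac{(B')_n}{n!}\,t^n$.
   Context: $\Gamma_2(B,B';x,y)=\sum_{m,n\ge0}(B)_{n-m}(B')_{m-n}\frac{x^m y^n}{m!\,n!}$ (a confluent Horn matrix function, not the gamma function). Matrix Pochhammer symbol: for $M\in\mathbb{C}^{d\times d}$, $(M)_0=I$, $(M)_n=M(M+I)\cdots(M+(n-1)I)$ for $n\ge1$, and $(M)_{-n}=(-1)^n(I-M)_n^{-1}$. For $|t|<1$, $(1-t)^{-M}=\sum_{n\ge0}\frac{(M)_n}{n!}t^n$. *)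

theory Defs
  imports "HOL-Analysis.Analysis"
begin

text \<open>Multiplication of a complex matrix by a complex scalar (the library's \<open>*\<^sub>R\<close> only
  covers real scalars).\<close>

definition cscale :: "complex \<Rightarrow> complex^'n^'m \<Rightarrow> complex^'n^'m" where
  "cscale c A = (\<chi> i j. c * A $ i $ j)"

primrec mpoch :: "complex^'d^'d \<Rightarrow> nat \<Rightarrow> complex^'d^'d" where
  "mpoch M 0 = mat 1"
| "mpoch M (Suc n) = mpoch M n ** (M + mat (of_nat n))"

text \<open>For a negative index this is meaningful only if \<open>mpoch (mat 1 - M) (nat (- k))\<close> is
  invertible, since \<open>matrix_inv\<close> of a singular matrix is unspecified.\<close>

definition mpoch_int :: "complex^'d^'d \<Rightarrow> int \<Rightarrow> complex^'d^'d" where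
  "mpoch_int M k =
    (if 0 \<le> k then mpoch M (nat k)
     else cscale ((-1) ^ nat (- k)) (matrix_inv (mpoch (mat 1 - M) (nat (- k)))))"

definition mpoch_int_defined :: "complex^'d^'d \<Rightarrow> bool" where
  "mpoch_int_defined M \<longleftrightarrow> (\<forall>n. invertible (mpoch (mat 1 - M) n))"

text \<open>The confluent Horn matrix function. The two matrix arguments need not commute, so the order
  of the factors matters. The double series is summed unconditionally over all pairs.\<close>

definition Gamma2 ::
  "complex^'d^'d \<Rightarrow> complex^'d^'d \<Rightarrow> complex \<Rightarrow> complex \<Rightarrow> complex^'d^'d" where
  "Gamma2 B B' x y =
    (\<Sum>\<^sub>\<infinity>(m, n)\<in>(UNIV :: (nat \<times> nat) set).
       cscale (x ^ m * y ^ n / (fact m * fact n))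
         (mpoch_int B (int n - int m) ** mpoch_int B' (int m - int n)))"

definition Gamma2_defined :: "complex^'d^'d \<Rightarrow> complex^'d^'d \<Rightarrow> bool" where
  "Gamma2_defined B B' \<longleftrightarrow> mpoch_int_defined B \<and> mpoch_int_defined B'"

text \<open>The matrix power \<open>(1 - t)\<close> to the exponent \<open>-M\<close>, for \<open>norm t < 1\<close>,
  given by its binomial series.\<close>

definition one_minus_powr_neg :: "complex \<Rightarrow> complex^'d^'d \<Rightarrow> complex^'d^'d" where
  "one_minus_powr_neg t M = (\<Sum>n. cscale (t ^ n / fact n) (mpoch M n))"

end

theory Submission
  imports Defs
begin

text \<open>
  Put \<open>j = k - m\<close> in the term of \<open>\<Gamma>\<^sub>2(B + n, B'; x, y)\<close> with powers \<open>x ^ m\<close> and \<open>y ^ k\<close>.  The first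
  summation formula rests on the identity \<open>(B)\<^sub>n (B + n)\<^sub>j = (B + j)\<^sub>n (B)\<^sub>j\<close>, valid for every integer
  \<open>j\<close> (\<open>mpoch_mult_mpoch_int_shift\<close>): both sides are \<open>(B)\<^bsub>n + j\<^esub>\<close>.  If the sum over \<open>n\<close> may be taken
  first, it is the binomial series of \<open>(1 - t)\<close> to the power \<open>- (B + j)\<close>, which equals
  \<open>(1 - t) powi (m - k)\<close> times the one for \<open>- B\<close> (\<open>one_minus_powr_neg_add_int\<close>).  The scalar factor
  turns \<open>x ^ m\<close> into \<open>(x (1 - t)) ^ m\<close> and \<open>y ^ k\<close> into \<open>(y / (1 - t)) ^ k\<close>, and the matrix factor
  comes out of the double sum on the left.

  The interchange needs absolute convergence of the triple series, which follows from two estimates.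
  First, \<open>(B)\<^sub>j\<close> and \<open>(B')\<^bsub>- j\<^esub>\<close> grow and decay like \<open>\<bar>j\<bar>!\<close> up to exponential factors, or conversely,
  so that the product of their norms is at most \<open>R ^ (m + k)\<close> (\<open>mpoch_int_pair_bound\<close>); against
  \<open>m! k!\<close> this is harmless.  Secondly, if \<open>b\<close> is the operator norm of \<open>B\<close>, that of
  \<open>(B + j)\<^sub>n\<close> is at most the scalar symbol \<open>(b + m + k)\<^sub>n\<close>, so that the sum over \<open>n\<close> costs at most
  \<open>(1 - norm t) powr - (b + m + k)\<close>, again only an exponential in \<open>m + k\<close>
  (\<open>shifted_terms_summable\<close>).

  The second formula is the transpose of the first: transposition reverses products, exchanging the
  roles of \<open>B\<close> and \<open>B'\<close> and of \<open>x\<close> and \<open>y\<close> (\<open>transpose_Gamma2\<close>).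
\<close>

section \<open>Matrix arithmetic\<close>

lemma matrix_mul_mat_left: "mat c ** A = cscale c (A :: complex^'d^'d)"
  by (vector cscale_def matrix_matrix_mult_def mat_def) (simp add: if_distrib if_distribR cong: if_cong)

lemma matrix_mul_mat_right: "A ** mat c = cscale c (A :: complex^'d^'d)"
  by (vector cscale_def matrix_matrix_mult_def mat_def) (simp add: if_distrib if_distribR mult.commute cong: if_cong)

lemma cscale_mult_left: "cscale c A ** B = cscale c ((A :: complex^'d^'d) ** (B :: complex^'d^'d))"
  by (simp add: matrix_mul_mat_left [symmetric] matrix_mul_assoc)

lemma cscale_mult_right: "A ** cscale c B = cscale c ((A :: complex^'d^'d) ** (B :: complex^'d^'d))"
  by (simp add: matrix_mul_mat_right [symmetric] matrix_mul_assoc)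

lemma cscale_cscale [simp]: "cscale c (cscale d A) = cscale (c * d) A"
  by (simp add: cscale_def vec_eq_iff mult.assoc)

lemma cscale_one [simp]: "cscale 1 A = A"
  by (vector cscale_def)

lemma cscale_zero_left [simp]: "cscale 0 A = 0"
  by (vector cscale_def)

lemma cscale_add_right: "cscale c (A + B) = cscale c A + cscale c B"
  by (vector cscale_def) (simp add: algebra_simps)

lemma cscale_add_left: "cscale (c + d) A = cscale c A + cscale d A"
  by (vector cscale_def) (simp add: algebra_simps)

lemma mat_add: "mat (a + b) = mat a + (mat b :: complex^'d^'d)"
  by (vector mat_def)

lemma diff_conv_cscale: "A - B = A + cscale (-1) (B :: complex^'d^'d)"
  by (vector cscale_def)

lemma matrix_add_distrib_right: "(A + B) ** C = A ** C + B ** (C :: complex^'d^'d)"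
  by (vector matrix_matrix_mult_def sum.distrib distrib_right)

lemma transpose_cscale: "transpose (cscale c A) = cscale c (transpose A)"
  by (vector cscale_def transpose_def)

lemma transpose_add: "transpose (A + B) = transpose A + transpose (B :: complex^'d^'d)"
  by (vector transpose_def)

lemma transpose_diff: "transpose (A - B) = transpose A - transpose (B :: complex^'d^'d)"
  by (vector transpose_def)

lemma matrix_inv_right: "invertible A \<Longrightarrow> A ** matrix_inv A = mat 1"
  unfolding invertible_def matrix_inv_def by (rule someI2_ex) auto

lemma matrix_inv_left: "invertible A \<Longrightarrow> matrix_inv A ** A = mat 1"
  unfolding invertible_def matrix_inv_def by (rule someI2_ex) auto

lemma matrix_inv_unique:
  fixes A B :: "complex^'d^'d"
  assumes "A ** B = mat 1"
  shows "matrix_inv A = B"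
  by (metis assms invertible_right_inverse matrix_inv_left matrix_mul_assoc matrix_mul_lid matrix_mul_rid)

lemma bounded_linear_cscale: "bounded_linear (cscale c :: complex^'d^'d \<Rightarrow> _)"
  unfolding linear_conv_bounded_linear [symmetric]
  by (rule linearI) (simp_all add: cscale_def vec_eq_iff algebra_simps)

lemma bounded_linear_matrix_mul_left: "bounded_linear (\<lambda>X. (A :: complex^'d^'d) ** X)"
  unfolding linear_conv_bounded_linear [symmetric]
  by (rule linearI)
     (vector matrix_matrix_mult_def, simp add: algebra_simps sum.distrib scaleR_sum_right)+

lemma bounded_linear_matrix_mul_right: "bounded_linear (\<lambda>X. X ** (A :: complex^'d^'d))"
  unfolding linear_conv_bounded_linear [symmetric]
  by (rule linearI)
     (vector matrix_matrix_mult_def, simp add: algebra_simps sum.distrib scaleR_sum_right)+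

lemma bounded_linear_transpose: "bounded_linear (transpose :: complex^'d^'d \<Rightarrow> _)"
  unfolding linear_conv_bounded_linear [symmetric]
  by (rule linearI) (vector transpose_def)+

section \<open>Algebra of the matrix Pochhammer symbol\<close>

lemma commute_matrix_inv:
  fixes A X :: "complex^'d^'d"
  assumes "invertible A" "A ** X = X ** A"
  shows "matrix_inv A ** X = X ** matrix_inv A"
  by (metis assms matrix_inv_left matrix_inv_right matrix_mul_assoc matrix_mul_lid matrix_mul_rid)

lemma commute_add_mat:
  fixes A X :: "complex^'d^'d"
  shows "A ** X = X ** A \<Longrightarrow> (A + mat c) ** X = X ** (A + mat c)"
  by (simp add: matrix_add_ldistrib matrix_add_distrib_right matrix_mul_mat_left matrix_mul_mat_right)

lemma mpoch_commute:
  assumes "M ** X = X ** M"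
  shows "mpoch M n ** X = X ** mpoch M n"
proof (induction n)
  case (Suc n)
  have "mpoch M n ** (M + mat (of_nat n)) ** X = mpoch M n ** X ** (M + mat (of_nat n))"
    using commute_add_mat [OF assms, of "of_nat n"] by (simp flip: matrix_mul_assoc)
  then show ?case using Suc by (simp add: matrix_mul_assoc)
qed simp

lemma mpoch_mpoch_commute:
  "M ** N = N ** M \<Longrightarrow> mpoch M m ** mpoch N n = mpoch N n ** mpoch M m"
  by (metis mpoch_commute)

lemma mpoch_add: "mpoch M (m + n) = mpoch M m ** mpoch (M + mat (of_nat m)) n"
  by (induction n) (simp_all add: matrix_mul_assoc mat_add add.assoc)

text \<open>Reversing the order of the factors of \<open>(1 - M)\<^sub>i\<close> and changing the sign of each turns it into
  a rising product, which can be concatenated with other symbols of shifts of \<open>M\<close>.\<close>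

lemma mpoch_reflect:
  "mpoch (mat 1 - M) i = cscale ((-1) ^ i) (mpoch (M - mat (of_nat i)) i)"
proof (induction i)
  case (Suc i)
  define N where "N = M - mat (of_nat (Suc i))"
  have *: "M - mat (of_nat i) = N + mat 1" "mat 1 - M + mat (of_nat i) = cscale (-1) N"
    unfolding N_def by (simp_all add: cscale_def mat_def vec_eq_iff)
  have "mpoch N (Suc i) = N ** mpoch (N + mat 1) i"
    using mpoch_add [of N 1 i] by simp
  also have "\<dots> = mpoch (N + mat 1) i ** N"
    by (rule mpoch_commute [symmetric]) (simp add: commute_add_mat)
  finally have N: "mpoch N (Suc i) = mpoch (N + mat 1) i ** N" .
  have "mpoch (mat 1 - M) (Suc i) = cscale ((-1) ^ i) (mpoch (N + mat 1) i) ** cscale (-1) N"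
    by (simp only: mpoch.simps(2) Suc *)
  also have "\<dots> = cscale ((-1) ^ Suc i) (mpoch N (Suc i))"
    unfolding N by (simp add: cscale_mult_left cscale_mult_right)
  finally show ?case by (simp only: N_def)
qed simp

lemma mpoch_int_nonneg [simp]: "mpoch_int M (int n) = mpoch M n"
  by (simp add: mpoch_int_def)

lemma mpoch_int_neg: "mpoch_int (M :: complex^'d^'d) (- int n) = cscale ((-1) ^ n) (matrix_inv (mpoch (mat 1 - M) n))"
proof (cases "n = 0")
  case True
  have "matrix_inv (mat 1 :: complex^'d^'d) = mat 1"
    by (rule matrix_inv_unique) simp
  then show ?thesis using True by (simp add: mpoch_int_def)
qed (simp add: mpoch_int_def)

text \<open>Both sides are the Pochhammer symbol of the integer index \<open>n + j\<close>.  For \<open>j = - i\<close> the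
  inverted symbols are, up to the sign \<open>(-1) ^ i\<close>, the products \<open>mpoch (M - mat i) i\<close> and
  \<open>mpoch (M - mat i + mat n) i\<close> by \<open>mpoch_reflect\<close>.  Splitting \<open>mpoch (M - mat i) (n + i)\<close> after
  \<open>i\<close> and after \<open>n\<close> factors relates these two, and the inverses can then be moved across the
  equation because everything is built from \<open>M\<close> and commutes.\<close>

lemma mpoch_mult_mpoch_int_shift:
  assumes "mpoch_int_defined M" "mpoch_int_defined (M + mat (of_nat n))"
  shows "mpoch M n ** mpoch_int (M + mat (of_nat n)) j = mpoch (M + mat (of_int j)) n ** mpoch_int M j"
proof (cases j rule: int_cases2)
  case (nonneg i)
  have "mpoch (M + mat (of_nat i)) n ** mpoch M i = mpoch M i ** mpoch (M + mat (of_nat i)) n"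
    by (simp add: mpoch_mpoch_commute commute_add_mat)
  then show ?thesis
    by (simp add: nonneg mpoch_add [symmetric] add.commute)
next
  case (nonpos i)
  define N where "N = M - mat (of_nat i)"
  define P where "P = mpoch (mat 1 - M) i"
  define Q where "Q = mpoch (mat 1 - (M + mat (of_nat n))) i"
  have inv: "invertible P" "invertible Q"
    using assms by (auto simp: mpoch_int_defined_def P_def Q_def)
  have P: "P = cscale ((-1) ^ i) (mpoch N i)"
    by (simp add: P_def N_def mpoch_reflect)
  have Q: "Q = cscale ((-1) ^ i) (mpoch (N + mat (of_nat n)) i)"
    by (simp add: Q_def N_def mpoch_reflect algebra_simps)
  have "mpoch N i ** mpoch M n = mpoch N n ** mpoch (N + mat (of_nat n)) i"
    using mpoch_add [of N i n] mpoch_add [of N n i] by (simp add: N_def add.commute)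
  then have eq: "P ** mpoch M n = mpoch N n ** Q"
    by (simp add: P Q cscale_mult_left cscale_mult_right)
  have PN: "P ** mpoch N n = mpoch N n ** P"
    unfolding P cscale_mult_left cscale_mult_right by (simp add: mpoch_mpoch_commute)
  have "mpoch M n ** matrix_inv Q = matrix_inv P ** (P ** mpoch M n) ** matrix_inv Q"
    using inv by (simp add: matrix_mul_assoc matrix_inv_left)
  also have "\<dots> = matrix_inv P ** mpoch N n ** (Q ** matrix_inv Q)"
    by (simp add: eq matrix_mul_assoc)
  also have "\<dots> = matrix_inv P ** mpoch N n"
    using inv by (simp add: matrix_inv_right)
  also have "\<dots> = mpoch N n ** matrix_inv P"
    using inv PN by (simp add: commute_matrix_inv)
  finally have "mpoch M n ** matrix_inv Q = mpoch N n ** matrix_inv P" .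
  moreover have "M + mat (- of_nat i) = N"
    unfolding N_def by (vector mat_def)
  ultimately show ?thesis
    by (simp add: nonpos mpoch_int_neg cscale_mult_right P_def Q_def)
qed

section \<open>Growth of the matrix Pochhammer symbol\<close>

text \<open>The norm of the type of matrices gives the identity the norm \<open>sqrt d\<close>, so that
  \<open>norm (M + mat n)\<close> could only be bounded by a multiple of \<open>n\<close>; the binomial series would then
  be controlled merely on a smaller disc.  The operator norm, under which the identity has norm at
  most \<open>1\<close>, loses nothing.\<close>

definition opnorm :: "complex^'d^'d \<Rightarrow> real" where
  "opnorm A = onorm ((*v) A)"

lemma opnorm_nonneg [simp]: "0 \<le> opnorm A"
  by (simp add: opnorm_def onorm_pos_le)

lemma opnorm_mult: "opnorm (A ** B) \<le> opnorm A * opnorm B"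
  using onorm_compose [of "(*v) A" "(*v) B"]
  by (simp add: opnorm_def o_def matrix_vector_mul_assoc)

lemma opnorm_add: "opnorm (A + B) \<le> opnorm A + opnorm B"
proof -
  have "(*v) (A + B) = (\<lambda>x. A *v x + B *v x)"
    by (simp add: fun_eq_iff matrix_vector_mult_add_rdistrib)
  then show ?thesis
    using onorm_triangle [of "(*v) A" "(*v) B"] by (simp add: opnorm_def)
qed

lemma norm_cscale_vec: "norm (c *s (v :: complex^'d)) = norm c * norm v"
  by (simp add: norm_vec_def norm_mult L2_set_right_distrib)

lemma opnorm_cscale: "opnorm (cscale c A) \<le> norm c * opnorm A"
proof -
  have "cscale c A *v v = c *s (A *v v)" for v
    by (vector cscale_def matrix_vector_mult_def) (simp add: sum_distrib_left mult.assoc)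
  then have "norm (cscale c A *v v) \<le> norm c * opnorm A * norm v" for v
    using onorm [of "(*v) A" v] by (simp add: norm_cscale_vec opnorm_def mult_left_mono mult.assoc)
  then show ?thesis
    unfolding opnorm_def by (intro onorm_bound) (auto simp: onorm_pos_le)
qed

lemma opnorm_mat: "opnorm (mat c :: complex^'d^'d) \<le> norm c"
proof -
  have "(*v) (mat 1 :: complex^'d^'d) = (\<lambda>v. v)"
    by (simp add: fun_eq_iff)
  then have "opnorm (mat 1 :: complex^'d^'d) \<le> 1"
    by (simp add: opnorm_def onorm_id_le)
  then have "opnorm (cscale c (mat 1) :: complex^'d^'d) \<le> norm c * 1"
    by (intro order_trans [OF opnorm_cscale] mult_left_mono) auto
  then show ?thesis
    by (simp add: matrix_mul_mat_left [symmetric])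
qed

lemma opnorm_mat_nat: "opnorm (mat (of_nat n) :: complex^'d^'d) \<le> real n"
  using opnorm_mat [of "of_nat n"] by simp

text \<open>Equivalence of the two norms, to carry summability back to the topology of the type.\<close>

lemma norm_le_opnorm: "norm (A :: complex^'d^'d) \<le> real CARD('d) ^ 2 * opnorm A"
proof -
  have component: "norm (A $ i $ j) \<le> opnorm A" for i j
  proof -
    have "A $ i $ j = (A *v axis j 1) $ i"
      by (simp add: matrix_vector_mult_def axis_def if_distrib cong: if_cong)
    also have "norm \<dots> \<le> norm (A *v axis j 1)"
      by (rule Finite_Cartesian_Product.norm_nth_le)
    also have "\<dots> \<le> opnorm A * norm (axis j 1 :: complex^'d)"
      unfolding opnorm_def by (rule onorm) simp
    also have "norm (axis j 1 :: complex^'d) = 1"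
    proof -
      have "(norm (axis j (1::complex) $ i))\<^sup>2 = (if i = j then 1 else 0)" for i
        by (simp add: axis_def)
      then show ?thesis by (simp add: norm_vec_def L2_set_def)
    qed
    finally show ?thesis by simp
  qed
  have "norm A \<le> (\<Sum>i\<in>UNIV. \<Sum>j\<in>UNIV. norm (A $ i $ j))"
    unfolding norm_vec_def [of A]
    by (rule order_trans [OF L2_set_le_sum]) (auto intro!: sum_mono simp: norm_vec_def L2_set_le_sum)
  also have "\<dots> \<le> (\<Sum>i\<in>(UNIV::'d set). \<Sum>j\<in>(UNIV::'d set). opnorm A)"
    by (intro sum_mono component)
  finally show ?thesis by (simp add: power2_eq_square mult.assoc)
qed

text \<open>The leading coefficient of \<open>n\<close> in each factor is exactly \<open>1\<close>; this is what makes the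
  binomial series converge on the whole disc \<open>norm t < 1\<close>.\<close>

lemma opnorm_mpoch_le_pochhammer:
  fixes M :: "complex^'d^'d"
  assumes "opnorm M \<le> b"
  shows "opnorm (mpoch M n) \<le> pochhammer b n"
proof (induction n)
  case 0
  show ?case using opnorm_mat [of 1] by simp
next
  case (Suc n)
  have "opnorm (mpoch M (Suc n)) \<le> opnorm (mpoch M n) * opnorm (M + mat (of_nat n))"
    by (simp add: opnorm_mult)
  also have "\<dots> \<le> pochhammer b n * (b + real n)"
  proof (rule mult_mono [OF Suc])
    show "opnorm (M + mat (of_nat n)) \<le> b + real n"
      using opnorm_add [of M "mat (of_nat n)"] opnorm_mat_nat [of n, where 'd = 'd] assms by simp
  qed (use order_trans [OF opnorm_nonneg Suc] in auto)
  finally show ?case by (simp add: pochhammer_Suc)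
qed

lemma opnorm_mpoch_le_fact:
  fixes M :: "complex^'d^'d"
  obtains R :: real where "R \<ge> 1" "\<And>n. opnorm (mpoch M n) \<le> R ^ n * fact n"
proof
  let ?R = "opnorm M + 1"
  show "?R \<ge> 1" by simp
  show "opnorm (mpoch M n) \<le> ?R ^ n * fact n" for n
  proof (induction n)
    case 0
    show ?case using opnorm_mat [of 1] by simp
  next
    case (Suc n)
    have "opnorm (mpoch M (Suc n)) \<le> opnorm (mpoch M n) * opnorm (M + mat (of_nat n))"
      by (simp add: opnorm_mult)
    also have "\<dots> \<le> (?R ^ n * fact n) * (?R * (real n + 1))"
    proof (rule mult_mono [OF Suc])
      have "opnorm (M + mat (of_nat n)) \<le> opnorm M + real n"
        using opnorm_add [of M "mat (of_nat n)"] opnorm_mat_nat [of n, where 'd = 'd] by simp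
      also have "\<dots> \<le> ?R * (real n + 1)"
        by (simp add: algebra_simps)
      finally show "opnorm (M + mat (of_nat n)) \<le> ?R * (real n + 1)" .
    qed auto
    finally show ?case by (simp add: algebra_simps)
  qed
qed

text \<open>The factor \<open>A + mat i\<close> behaves like \<open>i\<close> for large \<open>i\<close>, so its inverse has norm at most
  \<open>R / (i + 1)\<close> for a suitable \<open>R\<close>.\<close>

lemma opnorm_inv_mpoch_le:
  fixes A :: "complex^'d^'d"
  assumes inv: "\<And>n. invertible (mpoch A n)"
  obtains R :: real where "R \<ge> 1" "\<And>n. opnorm (matrix_inv (mpoch A n)) \<le> R ^ n / fact n"
proof -
  define W where "W i = matrix_inv (A + mat (of_nat i))" for i
  have invA: "invertible (A + mat (of_nat i))" for i
    using inv [of "Suc i"] unfolding invertible_left_inverse by (metis mpoch.simps(2) matrix_mul_assoc)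
  \<comment> \<open>From \<open>i * W i = 1 - A ** W i\<close> it follows that \<open>(i + 1) * opnorm (W i) \<le> 2\<close> as soon as
    \<open>i \<ge> 2 * opnorm A + 1\<close>; the finitely many earlier indices enter the constant through their sum.\<close>
  define N where "N = nat \<lceil>2 * opnorm A + 1\<rceil>"
  define R where "R = 2 + (\<Sum>i<N. (real i + 1) * opnorm (W i))"
  have W: "(real i + 1) * opnorm (W i) \<le> R" for i
  proof (cases "i < N")
    case True
    then have "(real i + 1) * opnorm (W i) \<le> (\<Sum>i<N. (real i + 1) * opnorm (W i))"
      by (intro member_le_sum) auto
    then show ?thesis by (simp add: R_def)
  next
    case False
    then have i: "real i \<ge> 2 * opnorm A + 1"
      unfolding N_def by linarith
    then have "i > 0"
      using opnorm_nonneg [of A] by (cases "i = 0") auto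
    have "A ** W i + cscale (of_nat i) (W i) = mat 1"
      using matrix_inv_right [OF invA [of i]]
      by (simp add: W_def matrix_add_distrib_right matrix_mul_mat_left)
    then have "mat 1 + cscale (-1) (A ** W i) = cscale (of_nat i) (W i)"
      by (metis diff_conv_cscale add_diff_cancel_left')
    then have "W i = cscale (1 / of_nat i) (mat 1 + cscale (-1) (A ** W i))"
      using \<open>i > 0\<close> by simp
    then have "opnorm (W i) \<le> (1 / real i) * opnorm (mat 1 + cscale (-1) (A ** W i))"
      by (metis opnorm_cscale norm_divide norm_of_nat norm_one)
    also have "\<dots> \<le> (1 / real i) * (1 + opnorm A * opnorm (W i))"
      using opnorm_add [of "mat 1" "cscale (-1) (A ** W i)"] opnorm_mat_nat [of 1, where 'd = 'd]
        opnorm_cscale [of "-1" "A ** W i"] opnorm_mult [of A "W i"]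
      by (intro mult_left_mono) auto
    finally have "real i * opnorm (W i) \<le> 1 + opnorm A * opnorm (W i)"
      using \<open>i > 0\<close> by (simp add: field_simps)
    moreover have "(2 * opnorm A + 1) * opnorm (W i) \<le> real i * opnorm (W i)"
      using i by (intro mult_right_mono) auto
    ultimately have "(real i + 1) * opnorm (W i) \<le> 2"
      by (simp add: algebra_simps)
    also have "2 \<le> R"
      by (simp add: R_def sum_nonneg)
    finally show ?thesis .
  qed
  have R: "R \<ge> 1"
    using sum_nonneg [of "{..<N}" "\<lambda>i. (real i + 1) * opnorm (W i)"] by (simp add: R_def)
  have "opnorm (matrix_inv (mpoch A n)) \<le> R ^ n / fact n" for n
  proof (induction n)
    case 0
    have "matrix_inv (mat 1 :: complex^'d^'d) = mat 1"
      by (rule matrix_inv_unique) simp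
    then show ?case using opnorm_mat_nat [of 1, where 'd = 'd] by simp
  next
    case (Suc n)
    have "mpoch A (Suc n) ** (W n ** matrix_inv (mpoch A n)) =
        mpoch A n ** ((A + mat (of_nat n)) ** W n) ** matrix_inv (mpoch A n)"
      by (simp add: matrix_mul_assoc)
    also have "\<dots> = mat 1"
      using invA inv by (simp add: W_def matrix_inv_right)
    finally have "matrix_inv (mpoch A (Suc n)) = W n ** matrix_inv (mpoch A n)"
      by (rule matrix_inv_unique)
    then have "opnorm (matrix_inv (mpoch A (Suc n))) \<le> opnorm (W n) * opnorm (matrix_inv (mpoch A n))"
      using opnorm_mult by metis
    also have "\<dots> \<le> (R / (real n + 1)) * (R ^ n / fact n)"
      using W [of n] Suc R by (intro mult_mono) (auto simp: field_simps)
    finally show ?case by (simp add: algebra_simps)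
  qed
  with R show ?thesis using that by blast
qed

section \<open>The binomial series of a matrix\<close>

lemma pochhammer_binomial_sums:
  fixes r a :: real
  assumes "\<bar>r\<bar> < 1"
  shows "(\<lambda>n. r ^ n / fact n * pochhammer a n) sums (1 - r) powr (- a)"
proof -
  have "(\<lambda>n. (- a gchoose n) * (- r) ^ n) sums (1 + - r) powr (- a)"
    using assms by (intro gen_binomial_real) auto
  moreover have "(- a gchoose n) * (- r) ^ n = r ^ n / fact n * pochhammer a n" for n
  proof -
    have "(- a gchoose n) * (- r) ^ n = ((-1) ^ n * (-1) ^ n) * (r ^ n / fact n * pochhammer a n)"
      unfolding gbinomial_pochhammer power_minus [of r n] by simp
    also have "((-1) ^ n * (-1) ^ n :: real) = 1"
      by (simp flip: power_mult_distrib)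
    finally show ?thesis by simp
  qed
  ultimately show ?thesis by simp
qed

lemma one_minus_powr_neg_has_sum:
  fixes M :: "complex^'d^'d"
  assumes "norm t < 1"
  shows "((\<lambda>n. cscale (t ^ n / fact n) (mpoch M n)) has_sum one_minus_powr_neg t M) UNIV"
proof -
  let ?g = "\<lambda>n. norm t ^ n / fact n * pochhammer (opnorm M) n"
  have 1: "summable (\<lambda>n. real CARD('d) ^ 2 * ?g n)"
    using pochhammer_binomial_sums [of "norm t" "opnorm M"] assms
    by (intro summable_mult) (auto simp: sums_iff)
  have 2: "norm (cscale (t ^ n / fact n) (mpoch M n)) \<le> real CARD('d) ^ 2 * ?g n" for n
  proof -
    have "opnorm (cscale (t ^ n / fact n) (mpoch M n)) \<le> norm (t ^ n / fact n) * opnorm (mpoch M n)"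
      by (rule opnorm_cscale)
    also have "\<dots> \<le> ?g n"
      unfolding norm_divide norm_power norm_fact
      by (intro mult_left_mono opnorm_mpoch_le_pochhammer) auto
    finally show ?thesis
      by (intro order_trans [OF norm_le_opnorm] mult_left_mono) auto
  qed
  have "summable (\<lambda>n. norm (cscale (t ^ n / fact n) (mpoch M n)))"
    by (rule summable_comparison_test' [OF 1, of 0]) (use 2 in simp)
  then show ?thesis
    unfolding one_minus_powr_neg_def
    by (simp add: norm_summable_imp_has_sum summable_sums summable_norm_cancel)
qed

lemma one_minus_powr_neg_sums:
  "norm t < 1 \<Longrightarrow> (\<lambda>n. cscale (t ^ n / fact n) (mpoch M n)) sums one_minus_powr_neg t M"
  by (intro has_sum_imp_sums one_minus_powr_neg_has_sum)

text \<open>The coefficients of both sides agree by the recurrence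
  \<open>(M + 1)\<^sub>n / n! - (M + 1)\<^bsub>n - 1\<^esub> / (n - 1)! = (M)\<^sub>n / n!\<close>.\<close>

lemma one_minus_powr_neg_add_one:
  fixes M :: "complex^'d^'d"
  assumes "norm t < 1"
  shows "cscale (1 - t) (one_minus_powr_neg t (M + mat 1)) = one_minus_powr_neg t M"
proof -
  define a where "a n = cscale (t ^ n / fact n) (mpoch (M + mat 1) n)" for n
  define b where "b n = cscale (t ^ n / fact n) (mpoch M n)" for n
  define S where "S = one_minus_powr_neg t (M + mat 1)"
  have a: "a sums S"
    unfolding a_def S_def using assms by (rule one_minus_powr_neg_sums)
  have b_Suc: "b (Suc n) = a (Suc n) - cscale t (a n)" for n
  proof -
    define P where "P = mpoch (M + mat 1) n"
    have PM: "P ** M = M ** P"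
      unfolding P_def by (intro mpoch_commute commute_add_mat refl)
    have "mpoch (M + mat 1) (Suc n) = P ** (M + mat (of_nat (Suc n)))"
      by (simp add: P_def mat_add add.assoc)
    also have "\<dots> = M ** P + cscale (of_nat (Suc n)) P"
      by (simp only: matrix_add_ldistrib PM matrix_mul_mat_right)
    finally have "a (Suc n) = cscale (t ^ Suc n / fact (Suc n)) (M ** P) + cscale (t ^ Suc n / fact n) P"
      by (simp add: a_def cscale_add_right field_simps del: of_nat_Suc mpoch.simps(2))
    moreover have "b (Suc n) = cscale (t ^ Suc n / fact (Suc n)) (M ** P)"
      using mpoch_add [of M 1 n] by (simp add: b_def P_def del: mpoch.simps(2)) simp
    moreover have "cscale t (a n) = cscale (t ^ Suc n / fact n) P"
      by (simp add: a_def P_def)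
    ultimately show ?thesis by simp
  qed
  have "(\<lambda>n. a (Suc n)) sums (S - a 0)"
    using a by (simp add: sums_Suc_iff)
  moreover have "(\<lambda>n. cscale t (a n)) sums cscale t S"
    using bounded_linear.sums [OF bounded_linear_cscale a] .
  ultimately have "(\<lambda>n. b (Suc n)) sums (S - a 0 - cscale t S)"
    unfolding b_Suc by (rule sums_diff)
  then have "b sums (S - cscale t S)"
    using sums_Suc_iff [of b "S - a 0 - cscale t S"] by (simp add: a_def b_def)
  moreover have "b sums one_minus_powr_neg t M"
    unfolding b_def using assms by (rule one_minus_powr_neg_sums)
  moreover have "cscale (1 - t) S = S - cscale t S"
    using cscale_add_left [of "1 - t" t S] by (simp add: algebra_simps)
  ultimately show ?thesis
    using sums_unique2 S_def by metis
qed

lemma one_minus_powr_neg_add_nat: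
  fixes M :: "complex^'d^'d"
  assumes "norm t < 1"
  shows "cscale ((1 - t) ^ n) (one_minus_powr_neg t (M + mat (of_nat n))) = one_minus_powr_neg t M"
proof (induction n)
  case (Suc n)
  have "M + mat (of_nat (Suc n)) = M + mat (of_nat n) + mat 1"
    by (simp add: mat_add)
  then have "cscale (1 - t) (one_minus_powr_neg t (M + mat (of_nat (Suc n)))) =
      one_minus_powr_neg t (M + mat (of_nat n))"
    by (simp only: one_minus_powr_neg_add_one [OF assms])
  with Suc show ?case
    by (metis cscale_cscale power_Suc2)
qed simp

lemma one_minus_powr_neg_add_int:
  fixes M :: "complex^'d^'d"
  assumes "norm t < 1"
  shows "one_minus_powr_neg t (M + mat (of_int j)) = cscale ((1 - t) powi (- j)) (one_minus_powr_neg t M)"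
proof (cases j rule: int_cases2)
  case (nonneg n)
  have "1 - t \<noteq> 0" using assms by auto
  then show ?thesis
    using one_minus_powr_neg_add_nat [OF assms, of n M, symmetric]
    by (simp add: nonneg power_int_minus)
next
  case (nonpos n)
  have *: "M + mat (- of_nat n) + mat (of_nat n) = M"
    using mat_add [of "- of_nat n" "of_nat n", where 'd = 'd] by (simp add: add.assoc)
  then show ?thesis
    using one_minus_powr_neg_add_nat [OF assms, of n "M + mat (- of_nat n)", unfolded *]
    by (simp add: nonpos)
qed

section \<open>Absolute convergence\<close>

text \<open>The indices are opposite, so the factorial growth of one symbol is compensated by the
  factorial decay of the other, and only exponential factors remain.  Hence the double series of \<open>Gamma2\<close> is dominated by the product of two exponential series.\<close>

lemma mpoch_int_pair_bound:
  assumes "Gamma2_defined B B'"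
  obtains R :: real where "R \<ge> 1"
    "\<And>m n. opnorm (mpoch_int B (int n - int m)) * opnorm (mpoch_int B' (int m - int n)) \<le> R ^ (m + n)"
proof -
  have *: "\<exists>R::real. R \<ge> 1 \<and> (\<forall>n. opnorm (mpoch_int M (int n)) \<le> R ^ n * fact n \<and>
      opnorm (mpoch_int M (- int n)) \<le> R ^ n / fact n)"
    if "mpoch_int_defined M" for M :: "complex^'a^'a"
  proof -
    obtain R1 :: real where R1: "R1 \<ge> 1" "\<And>n. opnorm (mpoch M n) \<le> R1 ^ n * fact n"
      using opnorm_mpoch_le_fact [of M] by blast
    have "invertible (mpoch (mat 1 - M) n)" for n
      using that by (simp add: mpoch_int_defined_def)
    then obtain R2 :: real where R2: "R2 \<ge> 1" "\<And>n. opnorm (matrix_inv (mpoch (mat 1 - M) n)) \<le> R2 ^ n / fact n"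
      using opnorm_inv_mpoch_le [of "mat 1 - M"] by blast
    have "opnorm (mpoch_int M (int n)) \<le> max R1 R2 ^ n * fact n" for n
      unfolding mpoch_int_nonneg
      using R1 by (intro order_trans [OF R1(2)] mult_right_mono power_mono) auto
    moreover have "opnorm (mpoch_int M (- int n)) \<le> max R1 R2 ^ n / fact n" for n
    proof -
      have "opnorm (mpoch_int M (- int n)) \<le> opnorm (matrix_inv (mpoch (mat 1 - M) n))"
        unfolding mpoch_int_neg by (rule order_trans [OF opnorm_cscale]) (simp add: norm_power)
      also have "\<dots> \<le> R2 ^ n / fact n" by (rule R2)
      also have "\<dots> \<le> max R1 R2 ^ n / fact n"
        using R2 by (intro divide_right_mono power_mono) auto
      finally show ?thesis .
    qed
    ultimately show ?thesis using R1(1) by (intro exI [of _ "max R1 R2"]) auto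
  qed
  obtain R :: real where R: "R \<ge> 1" "\<And>n. opnorm (mpoch_int B (int n)) \<le> R ^ n * fact n"
      "\<And>n. opnorm (mpoch_int B (- int n)) \<le> R ^ n / fact n"
    using * [of B] assms by (auto simp: Gamma2_defined_def)
  obtain R' :: real where R': "R' \<ge> 1" "\<And>n. opnorm (mpoch_int B' (int n)) \<le> R' ^ n * fact n"
      "\<And>n. opnorm (mpoch_int B' (- int n)) \<le> R' ^ n / fact n"
    using * [of B'] assms by (auto simp: Gamma2_defined_def)
  have RR: "R * R' \<ge> 1" using R(1) R'(1) mult_mono [of 1 R 1 R'] by simp
  have "opnorm (mpoch_int B (int n - int m)) * opnorm (mpoch_int B' (int m - int n)) \<le> (R * R') ^ (m + n)"
    for m n
  proof (cases "m \<le> n")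
    case True
    define k where "k = n - m"
    have k: "int n - int m = int k" "int m - int n = - int k" "k \<le> m + n"
      using True by (auto simp: k_def)
    have "opnorm (mpoch_int B (int k)) * opnorm (mpoch_int B' (- int k)) \<le> (R ^ k * fact k) * (R' ^ k / fact k)"
      using R R' by (intro mult_mono) auto
    also have "\<dots> = (R * R') ^ k" by (simp add: power_mult_distrib)
    also have "\<dots> \<le> (R * R') ^ (m + n)" using RR k by (intro power_increasing) auto
    finally show ?thesis by (simp only: k)
  next
    case False
    define k where "k = m - n"
    have k: "int n - int m = - int k" "int m - int n = int k" "k \<le> m + n"
      using False by (auto simp: k_def)
    have "opnorm (mpoch_int B (- int k)) * opnorm (mpoch_int B' (int k)) \<le> (R ^ k / fact k) * (R' ^ k * fact k)"
      using R R' by (intro mult_mono) auto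
    also have "\<dots> = (R * R') ^ k" by (simp add: power_mult_distrib)
    also have "\<dots> \<le> (R * R') ^ (m + n)" using RR k by (intro power_increasing) auto
    finally show ?thesis by (simp only: k)
  qed
  with RR show ?thesis using that by blast
qed

definition Gamma2_term ::
  "complex^'d^'d \<Rightarrow> complex^'d^'d \<Rightarrow> complex \<Rightarrow> complex \<Rightarrow> nat \<times> nat \<Rightarrow> complex^'d^'d" where
  "Gamma2_term B B' x y = (\<lambda>(m, n).
     cscale (x ^ m * y ^ n / (fact m * fact n))
       (mpoch_int B (int n - int m) ** mpoch_int B' (int m - int n)))"

lemma exp_product_summable_on:
  fixes a b :: real
  assumes "a \<ge> 0" "b \<ge> 0"
  shows "(\<lambda>(m, n). a ^ m / fact m * (b ^ n / fact n)) summable_on (UNIV :: (nat \<times> nat) set)"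
proof -
  have e: "((\<lambda>n. c ^ n / fact n) has_sum exp c) UNIV" if "c \<ge> 0" for c :: real
    using exp_converges [of c] that by (intro sums_nonneg_imp_has_sum) (auto simp: field_simps scaleR_conv_of_real)
  have "(\<lambda>(m, n). a ^ m / fact m * (b ^ n / fact n)) summable_on (UNIV \<times> UNIV :: (nat \<times> nat) set)"
  proof (rule summable_on_SigmaI)
    show "((\<lambda>n. case (m, n) of (m, n) \<Rightarrow> a ^ m / fact m * (b ^ n / fact n)) has_sum
        a ^ m / fact m * exp b) UNIV" for m :: nat
      using has_sum_cmult_right [OF e [OF assms(2)], of "a ^ m / fact m"] by simp
    show "(\<lambda>m. a ^ m / fact m * exp b) summable_on (UNIV :: nat set)"
      using has_sum_cmult_left [OF e [OF assms(1)], of "exp b"] by (auto simp: summable_on_def)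
  qed (use assms in auto)
  then show ?thesis by simp
qed

lemma opnorm_Gamma2_term_le:
  assumes "opnorm (mpoch_int B (int n - int m)) * opnorm (mpoch_int B' (int m - int n)) \<le> c"
  shows "opnorm (Gamma2_term B B' x y (m, n)) \<le> norm x ^ m / fact m * (norm y ^ n / fact n) * c"
proof -
  have "opnorm (Gamma2_term B B' x y (m, n)) \<le> norm (x ^ m * y ^ n / (fact m * fact n) :: complex) *
      opnorm (mpoch_int B (int n - int m) ** mpoch_int B' (int m - int n))"
    by (simp add: Gamma2_term_def opnorm_cscale)
  also have "\<dots> \<le> norm (x ^ m * y ^ n / (fact m * fact n) :: complex) * c"
    using assms opnorm_mult order_trans by (intro mult_left_mono) (blast, simp)
  finally show ?thesis by (simp add: norm_mult norm_divide norm_power)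
qed

lemma Gamma2_has_sum:
  fixes B B' :: "complex^'d^'d"
  assumes "Gamma2_defined B B'"
  shows "(Gamma2_term B B' x y has_sum Gamma2 B B' x y) UNIV"
proof -
  obtain R :: real where R: "R \<ge> 1"
    "\<And>m n. opnorm (mpoch_int B (int n - int m)) * opnorm (mpoch_int B' (int m - int n)) \<le> R ^ (m + n)"
    using mpoch_int_pair_bound [OF assms] by blast
  let ?g = "\<lambda>(m, n). (norm x * R) ^ m / fact m * ((norm y * R) ^ n / fact n)"
  have "(\<lambda>p. real CARD('d) ^ 2 * ?g p) summable_on UNIV"
    using R by (intro summable_on_cmult_right exp_product_summable_on) auto
  moreover have "norm (Gamma2_term B B' x y p) \<le> real CARD('d) ^ 2 * ?g p" for p
  proof (cases p)
    case (Pair m n)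
    have "opnorm (Gamma2_term B B' x y (m, n)) \<le> ?g (m, n)"
      using opnorm_Gamma2_term_le [OF R(2), of x y m n]
      by (simp add: power_mult_distrib power_add mult_ac)
    then show ?thesis
      unfolding Pair by (intro order_trans [OF norm_le_opnorm] mult_left_mono) auto
  qed
  ultimately have "(\<lambda>p. norm (Gamma2_term B B' x y p)) summable_on UNIV"
    by (intro Infinite_Sum.abs_summable_on_comparison_test') auto
  then have "Gamma2_term B B' x y summable_on UNIV"
    by (rule abs_summable_summable)
  then have "(Gamma2_term B B' x y has_sum (\<Sum>\<^sub>\<infinity>p. Gamma2_term B B' x y p)) UNIV"
    by (rule has_sum_infsum)
  moreover have "(\<Sum>\<^sub>\<infinity>p. Gamma2_term B B' x y p) = Gamma2 B B' x y"
    by (simp add: Gamma2_def Gamma2_term_def)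
  ultimately show ?thesis by simp
qed

section \<open>Interchanging the summations\<close>

lemma mpoch_mult_Gamma2_term:
  assumes "Gamma2_defined B B'" "Gamma2_defined (B + mat (of_nat n)) B'"
  shows "mpoch B n ** Gamma2_term (B + mat (of_nat n)) B' x y (m, k) =
    mpoch (B + mat (of_int (int k - int m))) n ** Gamma2_term B B' x y (m, k)"
  using mpoch_mult_mpoch_int_shift [of B n "int k - int m"] assms
  by (simp add: Gamma2_term_def Gamma2_defined_def cscale_mult_right matrix_mul_assoc)

text \<open>In the operator norm, the sum over \<open>n\<close> of the norms is at most
  \<open>(1 - norm t) powr - (opnorm B + m + k)\<close> times the norm of the term of the double series, by the
  scalar binomial series and because \<open>norm (k - m) \<le> m + k\<close>.  This factor is exponential in
  \<open>m + k\<close>, so the factorials of the double series still win.\<close>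

lemma shifted_terms_summable:
  fixes B B' :: "complex^'d^'d"
  assumes t: "norm t < 1" and "Gamma2_defined B B'"
  shows "(\<lambda>((m, k), n). cscale (t ^ n / fact n)
      (mpoch (B + mat (of_int (int k - int m))) n ** Gamma2_term B B' x y (m, k))) summable_on UNIV \<times> UNIV"
    (is "?T summable_on _")
proof -
  obtain R :: real where R: "R \<ge> 1"
    "\<And>m n. opnorm (mpoch_int B (int n - int m)) * opnorm (mpoch_int B' (int m - int n)) \<le> R ^ (m + n)"
    using mpoch_int_pair_bound [OF assms(2)] by blast
  define b where "b = opnorm B"
  define S where "S = 1 / (1 - norm t)"
  \<comment> \<open>\<open>h\<close> dominates the terms of the double series, \<open>G\<close> those of the triple series.  Summing \<open>G\<close> over
    \<open>n\<close> multiplies \<open>h (m, k)\<close> by a constant and \<open>S ^ (m + k)\<close>, which again gives exponential series.\<close>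
  define h where "h = (\<lambda>(m, k). (norm x * R) ^ m / fact m * ((norm y * R) ^ k / fact k))"
  define G where "G = (\<lambda>((m, k), n). real CARD('d) ^ 2 *
      (norm t ^ n / fact n * pochhammer (b + real (m + k)) n * h (m, k)))"
  have "S \<ge> 0" using t by (simp add: S_def)
  have h_nonneg: "0 \<le> h p" for p
    using R(1) by (cases p) (simp add: h_def)
  have poch_nonneg: "0 \<le> pochhammer (b + real (m + k)) n" for m k n
    using opnorm_mpoch_le_pochhammer [of B "b + real (m + k)" n]
    by (intro order_trans [OF opnorm_nonneg]) (simp add: b_def)
  have "G summable_on UNIV \<times> UNIV"
  proof (rule summable_on_SigmaI)
    show "((\<lambda>n. G (p, n)) has_sum (case p of (m, k) \<Rightarrow> real CARD('d) ^ 2 *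
        ((1 - norm t) powr (- (b + real (m + k))) * h (m, k)))) UNIV" for p
    proof (cases p)
      case (Pair m k)
      show ?thesis
        unfolding Pair G_def prod.case
        using t h_nonneg poch_nonneg
        by (intro sums_nonneg_imp_has_sum sums_mult sums_mult2 pochhammer_binomial_sums) auto
    qed
    have "(\<lambda>p. real CARD('d) ^ 2 * ((1 - norm t) powr (- b) *
        (\<lambda>(m, k). (norm x * R * S) ^ m / fact m * ((norm y * R * S) ^ k / fact k)) p)) summable_on UNIV"
      using R \<open>S \<ge> 0\<close> by (intro summable_on_cmult_right exp_product_summable_on) auto
    moreover have "(1 - norm t) powr (- (b + real (m + k))) = (1 - norm t) powr (- b) * S ^ (m + k)" for m k
    proof -
      have "(1 - norm t) powr (- (b + real (m + k))) = (1 - norm t) powr (- b) * (1 - norm t) powr (- real (m + k))"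
        by (simp only: minus_add_distrib powr_add)
      also have "(1 - norm t) powr (- real (m + k)) = S ^ (m + k)"
        using t by (simp only: powr_minus) (simp add: S_def powr_realpow power_one_over inverse_eq_divide del: of_nat_add)
      finally show ?thesis .
    qed
    ultimately show "(\<lambda>(m, k). real CARD('d) ^ 2 *
        ((1 - norm t) powr (- (b + real (m + k))) * h (m, k))) summable_on UNIV"
      by (simp add: h_def case_prod_unfold power_mult_distrib power_add mult_ac)
    show "0 \<le> G (p, n)" for p n
      using h_nonneg poch_nonneg by (cases p) (simp add: G_def)
  qed
  moreover have "norm (?T q) \<le> G q" for q
  proof -
    obtain m k n where q: "q = ((m, k), n)" by (metis prod.exhaust)
    let ?M = "B + mat (of_int (int k - int m))"
    have "opnorm ?M \<le> b + real (m + k)"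
      using opnorm_add [of B "mat (of_int (int k - int m))"]
        opnorm_mat [of "of_int (int k - int m)", where 'd = 'd]
      by (simp add: b_def) (smt (verit) norm_of_nat norm_triangle_ineq4 of_nat_add)
    then have 1: "opnorm (mpoch ?M n) \<le> pochhammer (b + real (m + k)) n"
      by (rule opnorm_mpoch_le_pochhammer)
    have 2: "opnorm (Gamma2_term B B' x y (m, k)) \<le> h (m, k)"
      using opnorm_Gamma2_term_le [OF R(2), of x y m k]
      by (simp add: h_def power_mult_distrib power_add mult_ac)
    have "opnorm (?T q) \<le> norm (t ^ n / fact n) * opnorm (mpoch ?M n ** Gamma2_term B B' x y (m, k))"
      unfolding q prod.case by (rule opnorm_cscale)
    also have "\<dots> \<le> norm (t ^ n / fact n) * (opnorm (mpoch ?M n) * opnorm (Gamma2_term B B' x y (m, k)))"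
      by (intro mult_left_mono opnorm_mult) auto
    also have "\<dots> \<le> norm (t ^ n / fact n) * (pochhammer (b + real (m + k)) n * h (m, k))"
      using 1 2 poch_nonneg by (intro mult_left_mono mult_mono) auto
    finally have "opnorm (?T q) \<le> norm t ^ n / fact n * pochhammer (b + real (m + k)) n * h (m, k)"
      by (simp add: norm_divide norm_power)
    then show ?thesis
      unfolding G_def q prod.case
      by (intro order_trans [OF norm_le_opnorm] mult_left_mono) auto
  qed
  ultimately have "(\<lambda>q. norm (?T q)) summable_on UNIV \<times> UNIV"
    by (intro Infinite_Sum.abs_summable_on_comparison_test') auto
  then show ?thesis by (rule abs_summable_summable)
qed

lemma Gamma2_term_rescale:
  assumes "t \<noteq> (1 :: complex)"
  shows "Gamma2_term B B' (x * (1 - t)) (y / (1 - t)) (m, k) =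
    cscale ((1 - t) powi (int m - int k)) (Gamma2_term B B' x y (m, k))"
proof -
  have "(x * (1 - t)) ^ m * (y / (1 - t)) ^ k / (fact m * fact k) =
      (1 - t) powi (int m - int k) * (x ^ m * y ^ k / (fact m * fact k))"
    using assms by (simp add: power_int_diff power_mult_distrib power_divide)
  then show ?thesis by (simp add: Gamma2_term_def)
qed

text \<open>The sum \<open>L\<close> of the triple series is computed in both orders: \<open>n\<close> first yields the closed form,
  \<open>(m, k)\<close> first yields the series of \<open>Gamma2\<close> functions.\<close>

lemma Gamma2_summation_left:
  fixes B B' :: "complex^'d^'d"
  assumes t: "norm t < 1" and defd: "\<And>n::nat. Gamma2_defined (B + mat (of_nat n)) B'"
  shows "(\<lambda>n. cscale (t ^ n / fact n) (mpoch B n ** Gamma2 (B + mat (of_nat n)) B' x y))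
    sums (one_minus_powr_neg t B ** Gamma2 B B' (x * (1 - t)) (y / (1 - t)))"
proof -
  have defd0: "Gamma2_defined B B'"
    using defd [of 0] by simp
  define T where "T = (\<lambda>(p, n). cscale (t ^ n / fact n)
    (mpoch B n ** Gamma2_term (B + mat (of_nat n)) B' x y p))"
  have T_eq: "T ((m, k), n) = cscale (t ^ n / fact n)
      (mpoch (B + mat (of_int (int k - int m))) n ** Gamma2_term B B' x y (m, k))" for m k n
    by (simp add: T_def mpoch_mult_Gamma2_term [OF defd0 defd])
  have "T = (\<lambda>((m, k), n). cscale (t ^ n / fact n)
      (mpoch (B + mat (of_int (int k - int m))) n ** Gamma2_term B B' x y (m, k)))"
    by (rule ext) (simp only: T_eq split_paired_all prod.case)
  then have "T summable_on UNIV \<times> UNIV"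
    using shifted_terms_summable [OF t defd0, of x y] by (simp only:)
  then obtain L where L: "(T has_sum L) (UNIV \<times> UNIV)"
    by (auto simp: summable_on_def)
  have "((\<lambda>n. T ((m, k), n)) has_sum
      one_minus_powr_neg t B ** Gamma2_term B B' (x * (1 - t)) (y / (1 - t)) (m, k)) UNIV" for m k
  proof -
    let ?M = "B + mat (of_int (int k - int m))"
    have "((\<lambda>n. cscale (t ^ n / fact n) (mpoch ?M n) ** Gamma2_term B B' x y (m, k)) has_sum
        one_minus_powr_neg t ?M ** Gamma2_term B B' x y (m, k)) UNIV"
      by (rule has_sum_bounded_linear [OF bounded_linear_matrix_mul_right one_minus_powr_neg_has_sum [OF t]])
    moreover have "t \<noteq> 1" using t by auto
    ultimately show ?thesis
      by (simp only: T_eq Gamma2_term_rescale [OF \<open>t \<noteq> 1\<close>] one_minus_powr_neg_add_int [OF t] cscale_mult_left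
          cscale_mult_right minus_diff_eq)
  qed
  then have "((\<lambda>n. T (p, n)) has_sum
      one_minus_powr_neg t B ** Gamma2_term B B' (x * (1 - t)) (y / (1 - t)) p) UNIV" for p
    by (cases p) auto
  then have "((\<lambda>p. one_minus_powr_neg t B ** Gamma2_term B B' (x * (1 - t)) (y / (1 - t)) p) has_sum L) UNIV"
    by (rule has_sum_SigmaD [OF L])
  moreover have "((\<lambda>p. one_minus_powr_neg t B ** Gamma2_term B B' (x * (1 - t)) (y / (1 - t)) p) has_sum
      one_minus_powr_neg t B ** Gamma2 B B' (x * (1 - t)) (y / (1 - t))) UNIV"
    by (rule has_sum_bounded_linear [OF bounded_linear_matrix_mul_left Gamma2_has_sum [OF defd0]])
  ultimately have L_eq: "L = one_minus_powr_neg t B ** Gamma2 B B' (x * (1 - t)) (y / (1 - t))"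
    by (rule has_sum_unique)
  have "((\<lambda>(n, p). T (p, n)) has_sum L) (UNIV \<times> UNIV)"
    using L by (subst (asm) has_sum_swap)
  then have "((\<lambda>n. cscale (t ^ n / fact n) (mpoch B n ** Gamma2 (B + mat (of_nat n)) B' x y)) has_sum L) UNIV"
  proof (rule has_sum_SigmaD)
    fix n :: nat
    have "((\<lambda>p. mpoch B n ** Gamma2_term (B + mat (of_nat n)) B' x y p) has_sum
        mpoch B n ** Gamma2 (B + mat (of_nat n)) B' x y) UNIV"
      by (rule has_sum_bounded_linear [OF bounded_linear_matrix_mul_left Gamma2_has_sum [OF defd]])
    then show "((\<lambda>p. case (n, p) of (n, p) \<Rightarrow> T (p, n)) has_sum
        cscale (t ^ n / fact n) (mpoch B n ** Gamma2 (B + mat (of_nat n)) B' x y)) UNIV"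
      unfolding T_def prod.case by (rule has_sum_bounded_linear [OF bounded_linear_cscale])
  qed
  then show ?thesis
    unfolding L_eq by (rule has_sum_imp_sums)
qed

section \<open>Transposition\<close>

lemma transpose_mpoch: "transpose (mpoch M n) = mpoch (transpose M) n"
proof (induction n)
  case (Suc n)
  have "mpoch (transpose M) n ** (transpose M + mat (of_nat n)) =
      (transpose M + mat (of_nat n)) ** mpoch (transpose M) n"
    by (intro mpoch_commute commute_add_mat [symmetric]) simp
  then show ?case
    by (simp add: Suc matrix_transpose_mul transpose_add)
qed simp

lemma invertible_transpose_iff: "invertible (transpose A) \<longleftrightarrow> invertible (A :: complex^'d^'d)"
proof -
  have "invertible A \<Longrightarrow> invertible (transpose A)" for A :: "complex^'d^'d"
    unfolding invertible_def by (metis matrix_transpose_mul transpose_mat)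
  from this [of A] this [of "transpose A"] show ?thesis by auto
qed

lemma transpose_matrix_inv:
  fixes A :: "complex^'d^'d"
  assumes "invertible A"
  shows "transpose (matrix_inv A) = matrix_inv (transpose A)"
  by (rule matrix_inv_unique [symmetric]) (metis assms matrix_inv_left matrix_transpose_mul transpose_mat)

lemma mpoch_int_defined_transpose: "mpoch_int_defined (transpose M) \<longleftrightarrow> mpoch_int_defined M"
proof -
  have "mpoch (mat 1 - transpose M) n = transpose (mpoch (mat 1 - M) n)" for n
    by (simp add: transpose_mpoch transpose_diff)
  then show ?thesis
    by (simp add: mpoch_int_defined_def invertible_transpose_iff)
qed

lemma transpose_mpoch_int:
  assumes "mpoch_int_defined M"
  shows "transpose (mpoch_int M j) = mpoch_int (transpose M) j"
  using assms unfolding mpoch_int_def mpoch_int_defined_def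
  by (simp add: transpose_cscale transpose_matrix_inv transpose_mpoch transpose_diff)

lemma transpose_one_minus_powr_neg:
  assumes "norm t < 1"
  shows "transpose (one_minus_powr_neg t M) = one_minus_powr_neg t (transpose M)"
  using bounded_linear.sums [OF bounded_linear_transpose one_minus_powr_neg_sums [OF assms, of M]]
    one_minus_powr_neg_sums [OF assms, of "transpose M"]
  by (simp add: transpose_cscale transpose_mpoch sums_unique2)

lemma Gamma2_defined_transpose: "Gamma2_defined (transpose B') (transpose B) \<longleftrightarrow> Gamma2_defined B B'"
  by (auto simp: Gamma2_defined_def mpoch_int_defined_transpose)

text \<open>Transposition reverses the two factors of each term; exchanging the summation indices brings
  the term back to the shape in the definition of \<open>Gamma2\<close>, with \<open>x\<close> and \<open>y\<close> exchanged.\<close>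

lemma transpose_Gamma2:
  assumes "Gamma2_defined B B'"
  shows "transpose (Gamma2 B B' x y) = Gamma2 (transpose B') (transpose B) y x"
proof -
  have "((\<lambda>p. transpose (Gamma2_term B B' x y p)) has_sum transpose (Gamma2 B B' x y)) (UNIV \<times> UNIV)"
    using has_sum_bounded_linear [OF bounded_linear_transpose Gamma2_has_sum [OF assms]] by simp
  moreover have "(\<lambda>(m, n). Gamma2_term (transpose B') (transpose B) y x (n, m)) = (\<lambda>p. transpose (Gamma2_term B B' x y p))"
    using assms
    by (auto simp: fun_eq_iff Gamma2_term_def Gamma2_defined_def transpose_cscale matrix_transpose_mul
        transpose_mpoch_int mult.commute)
  ultimately have "(Gamma2_term (transpose B') (transpose B) y x has_sum transpose (Gamma2 B B' x y)) (UNIV \<times> UNIV)"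
    by (subst has_sum_swap) (simp only: cond_case_prod_eta)
  moreover have "(Gamma2_term (transpose B') (transpose B) y x has_sum
      Gamma2 (transpose B') (transpose B) y x) (UNIV \<times> UNIV)"
    using Gamma2_has_sum [of "transpose B'" "transpose B"] assms by (simp add: Gamma2_defined_transpose)
  ultimately show ?thesis by (rule has_sum_unique)
qed

lemma Gamma2_summation_right:
  fixes B B' :: "complex^'d^'d"
  assumes t: "norm t < 1" and defd: "\<And>n::nat. Gamma2_defined B (B' + mat (of_nat n))"
  shows "(\<lambda>n. cscale (t ^ n / fact n) (Gamma2 B (B' + mat (of_nat n)) x y ** mpoch B' n))
    sums (Gamma2 B B' (x / (1 - t)) (y * (1 - t)) ** one_minus_powr_neg t B')"
proof -
  have tr: "transpose (B' + mat (of_nat n)) = transpose B' + mat (of_nat n)" for n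
    by (simp add: transpose_add)
  have defd': "Gamma2_defined (transpose B' + mat (of_nat n)) (transpose B)" for n
    using defd [of n] by (simp only: tr [symmetric] Gamma2_defined_transpose)
  have defd0: "Gamma2_defined B B'" using defd [of 0] by simp
  have 1: "transpose (mpoch (transpose B') n ** Gamma2 (transpose B' + mat (of_nat n)) (transpose B) y x) =
      Gamma2 B (B' + mat (of_nat n)) x y ** mpoch B' n" for n
    using transpose_Gamma2 [OF defd, of n x y, symmetric]
    by (simp add: matrix_transpose_mul transpose_mpoch tr)
  have 2: "transpose (one_minus_powr_neg t (transpose B') **
        Gamma2 (transpose B') (transpose B) (y * (1 - t)) (x / (1 - t))) =
      Gamma2 B B' (x / (1 - t)) (y * (1 - t)) ** one_minus_powr_neg t B'"
    by (simp add: matrix_transpose_mul transpose_one_minus_powr_neg t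
        flip: transpose_Gamma2 [OF defd0])
  from bounded_linear.sums [OF bounded_linear_transpose
      Gamma2_summation_left [OF t defd', of y x]]
  show ?thesis by (simp only: transpose_cscale 1 2)
qed

theorem theorem5p12:
  fixes B B' :: "complex^'d^'d" and x y t :: complex
  assumes "norm t < 1"
  shows "((\<forall>n::nat. Gamma2_defined (B + mat (of_nat n)) B') \<longrightarrow>
           (\<lambda>n. cscale (t ^ n / fact n)
                  (mpoch B n ** Gamma2 (B + mat (of_nat n)) B' x y))
           sums (one_minus_powr_neg t B ** Gamma2 B B' (x * (1 - t)) (y / (1 - t))))
       \<and> ((\<forall>n::nat. Gamma2_defined B (B' + mat (of_nat n))) \<longrightarrow>
           (\<lambda>n. cscale (t ^ n / fact n)
                  (Gamma2 B (B' + mat (of_nat n)) x y ** mpoch B' n))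
           sums (Gamma2 B B' (x / (1 - t)) (y * (1 - t)) ** one_minus_powr_neg t B'))"
  using Gamma2_summation_left [OF assms] Gamma2_summation_right [OF assms] by blast

end
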